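(* Let $(\mathbb{R}^d,\delta)$ be a diversity. Then $(\mathbb{R}^d,\delta)$ is a Minkowski diversity if and only if $\delta$ is sublinear and for all finite $A,B \subseteq \mathbb{R}^d$ there are $a,b \in \mathbb{R}^d$ such that \[ \delta( (A + a) \cup (B + b) ) \leq \max\{\delta(A),\delta(B)\}.\]
   Context: A convex body in $\mathbb{R}^d$ is a compact, convex set with non-empty interior. For a convex body $K$ in $\mathbb{R}^d$ and bounded $A \subseteq \mathbb{R}^d$, the generalized circumradius of $A$ with respect to $K$ is \[R(A,K) = \inf\{\lambda \ge 0 : A \subseteq \lambda K+x \mbox{ for some } x \in \mathbb{R}^d\}.\] A diversity is a pair $(X,\delta)$ where $X$ is a set and $\delta$ is a function from the finite subsets of $X$ to $\mathbb{R}_{\geq 0}$ such that, for all finite $A,B,C \subseteq X$: (D1) $\delta(A)=0$ if and only if $|A| \leq 1$; (D2) if $B \neq \emptyset$ then $\delta(A \cup C) \leq \delta(A \cup B) + \delta(B \cup C)$. A diversity $(\mathbb{R}^d,\delta)$ is a Minkowski diversity if there is a convex body $K \subseteq \mathbb{R}^d$ such that $\delta(A) = R(A,K)$ for all finite $A \subset \mathbb{R}^d$. A diversity $(\mathbb{R}^d,\delta)$ is sublinear if $\delta(A+B) \leq \delta(A) + \delta(B)$ and $\delta(\lambda A) = \lambda \delta(A)$ for all finite $A,B \subseteq \mathbb{R}^d$ and all real $\lambda \geq 0$, where $A+B$ denotes the Minkowski sum. *)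

theory Defs
  imports "HOL-Analysis.Analysis"
begin

text \<open>
  A diversity is a function on the finite subsets of \<open>X\<close>; it is rendered by a total function
  on sets, whose values are only ever constrained or used on finite subsets of \<open>X\<close>.
\<close>

definition diversity :: "'a set \<Rightarrow> ('a set \<Rightarrow> real) \<Rightarrow> bool" where
  "diversity X \<delta> \<longleftrightarrow>
     (\<forall>A. finite A \<and> A \<subseteq> X \<longrightarrow> \<delta> A \<ge> 0) \<and>
     (\<forall>A. finite A \<and> A \<subseteq> X \<longrightarrow> (\<delta> A = 0 \<longleftrightarrow> card A \<le> 1)) \<and>
     (\<forall>A B C. finite A \<and> A \<subseteq> X \<and> finite B \<and> B \<subseteq> X \<and> finite C \<and> C \<subseteq> X \<and> B \<noteq> {} \<longrightarrow>
        \<delta> (A \<union> C) \<le> \<delta> (A \<union> B) + \<delta> (B \<union> C))"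

definition convex_body :: "'a::euclidean_space set \<Rightarrow> bool" where
  "convex_body K \<longleftrightarrow> compact K \<and> convex K \<and> interior K \<noteq> {}"

text \<open>
  The infimum is a real one. It is the intended value whenever \<open>K\<close> is a convex body and \<open>A\<close> is
  bounded, as the set of admissible factors is then nonempty.
\<close>

definition gen_circumradius :: "'a::euclidean_space set \<Rightarrow> 'a set \<Rightarrow> real" where
  "gen_circumradius A K = Inf {r. r \<ge> 0 \<and> (\<exists>x. A \<subseteq> (\<lambda>y. r *\<^sub>R y + x) ` K)}"

definition Minkowski_diversity :: "('a::euclidean_space set \<Rightarrow> real) \<Rightarrow> bool" where
  "Minkowski_diversity \<delta> \<longleftrightarrow>
     diversity UNIV \<delta> \<and>
     (\<exists>K. convex_body K \<and> (\<forall>A. finite A \<longrightarrow> \<delta> A = gen_circumradius A K))"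

text \<open>The sum \<open>A + B\<close> of sets is the elementwise (Minkowski) sum.\<close>

definition sublinear_diversity :: "('a::euclidean_space set \<Rightarrow> real) \<Rightarrow> bool" where
  "sublinear_diversity \<delta> \<longleftrightarrow>
     diversity UNIV \<delta> \<and>
     (\<forall>A B. finite A \<and> finite B \<longrightarrow> \<delta> (A + B) \<le> \<delta> A + \<delta> B) \<and>
     (\<forall>A r. finite A \<and> r \<ge> 0 \<longrightarrow> \<delta> ((\<lambda>x. r *\<^sub>R x) ` A) = r * \<delta> A)"

end

theory Submission
  imports Defs
begin

text \<open>
  If \<open>\<delta>\<close> comes from \<open>K\<close>, the infimum defining the circumradius is attained by compactness, so
  finite sets \<open>A\<close> and \<open>B\<close> have translates inside one homothet of \<open>K\<close> of factor
  \<open>max (\<delta> A) (\<delta> B)\<close>.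

  Conversely, Zorn's lemma yields a maximal set \<open>K\<close> all of whose finite subsets \<open>F\<close> satisfy
  \<open>\<delta> F \<le> 1\<close>. Maximality makes \<open>K\<close> closed and convex, and the union property together with a
  compactness argument on the translation vectors shows that \<open>K\<close> contains a translate of every
  finite \<open>A\<close> with \<open>\<delta> A \<le> 1\<close>. Hence \<open>\<delta> A \<le> r\<close> holds exactly if \<open>A\<close> has a translate in \<open>r K\<close>.
\<close>

section \<open>The generalized circumradius\<close>

text \<open>The admissible factors get a name of their own so that covers can be added, scaled and
  compared before any infimum is taken.\<close>

definition homothetically_covered :: "'a::euclidean_space set \<Rightarrow> 'a set \<Rightarrow> real \<Rightarrow> bool" where
  "homothetically_covered K A r \<longleftrightarrow> r \<ge> 0 \<and> (\<exists>x. A \<subseteq> (\<lambda>y. r *\<^sub>R y + x) ` K)"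

lemma gen_circumradius_alt: "gen_circumradius A K = Inf {r. homothetically_covered K A r}"
  by (simp add: gen_circumradius_def homothetically_covered_def)

lemma homothetically_coveredI:
  "r \<ge> 0 \<Longrightarrow> A \<subseteq> (\<lambda>y. r *\<^sub>R y + x) ` K \<Longrightarrow> homothetically_covered K A r"
  unfolding homothetically_covered_def by blast

text \<open>Convexity gives \<open>r K + s K \<subseteq> (r + s) K\<close>; this is where
  subadditivity of the circumradius comes from.\<close>

lemma homothetically_covered_Minkowski_sum:
  assumes "convex K" "homothetically_covered K A r" "homothetically_covered K B s"
  shows "homothetically_covered K (A + B) (r + s)"
proof -
  from assms obtain x y where nn: "r \<ge> 0" "s \<ge> 0"
    and x: "A \<subseteq> (\<lambda>k. r *\<^sub>R k + x) ` K" and y: "B \<subseteq> (\<lambda>k. s *\<^sub>R k + y) ` K"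
    by (auto simp: homothetically_covered_def)
  have "a + b \<in> (\<lambda>k. (r + s) *\<^sub>R k + (x + y)) ` K" if ab: "a \<in> A" "b \<in> B" for a b
  proof -
    obtain k l where k: "k \<in> K" "a = r *\<^sub>R k + x" and l: "l \<in> K" "b = s *\<^sub>R l + y"
      using ab x y by blast
    show ?thesis
    \<comment> \<open>The convex weights used below divide by \<open>r + s\<close>. If it vanishes,
      both sets are covered by a single point.\<close>
    proof (cases "r + s = 0")
      case True
      then have "r = 0" "s = 0" using nn by auto
      then show ?thesis using k l by auto
    next
      case False
      define m where "m = (r / (r + s)) *\<^sub>R k + (s / (r + s)) *\<^sub>R l"
      have "m \<in> K"
        unfolding m_def using False nn
        by (intro convexD[OF \<open>convex K\<close>] k l) (auto simp flip: add_divide_distrib)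
      moreover have "(r + s) *\<^sub>R m = r *\<^sub>R k + s *\<^sub>R l"
        using False by (simp add: m_def scaleR_add_right)
      then have "a + b = (r + s) *\<^sub>R m + (x + y)" using k l by (simp add: algebra_simps)
      ultimately show ?thesis by blast
    qed
  qed
  then have "A + B \<subseteq> (\<lambda>k. (r + s) *\<^sub>R k + (x + y)) ` K" by (auto elim!: set_plus_elim)
  then show ?thesis using nn by (intro homothetically_coveredI) auto
qed

lemma homothetically_covered_scaleR:
  assumes "homothetically_covered K A r" "s \<ge> 0"
  shows "homothetically_covered K ((\<lambda>x. s *\<^sub>R x) ` A) (s * r)"
proof -
  from assms obtain x where "r \<ge> 0" and x: "A \<subseteq> (\<lambda>k. r *\<^sub>R k + x) ` K"
    by (auto simp: homothetically_covered_def)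
  have "(\<lambda>x. s *\<^sub>R x) ` A \<subseteq> (\<lambda>x. s *\<^sub>R x) ` (\<lambda>k. r *\<^sub>R k + x) ` K"
    using x by (rule image_mono)
  also have "\<dots> = (\<lambda>k. (s * r) *\<^sub>R k + s *\<^sub>R x) ` K"
    by (simp add: image_image scaleR_add_right)
  finally show ?thesis
    using \<open>r \<ge> 0\<close> \<open>s \<ge> 0\<close> by (intro homothetically_coveredI) auto
qed

lemma homothetically_covered_singleton:
  assumes "K \<noteq> {}" "r \<ge> 0"
  shows "homothetically_covered K {a} r"
proof -
  obtain k where "k \<in> K" using assms by blast
  then show ?thesis using assms
    by (intro homothetically_coveredI[where x = "a - r *\<^sub>R k"]) auto
qed

text \<open>Since \<open>K\<close> may miss the origin, \<open>r K \<subseteq> s K\<close> can fail.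
  Instead \<open>A\<close> is written as \<open>A + {0}\<close>, and the singleton absorbs the
  surplus factor \<open>s - r\<close>.\<close>

lemma homothetically_covered_mono:
  assumes "convex K" "K \<noteq> {}" "homothetically_covered K A r" "r \<le> s"
  shows "homothetically_covered K A s"
proof -
  have "homothetically_covered K (A + {0}) (r + (s - r))"
    using assms by (intro homothetically_covered_Minkowski_sum homothetically_covered_singleton) auto
  then show ?thesis by simp
qed

lemma homothetically_covered_bounded:
  assumes "interior K \<noteq> {}" "bounded A"
  shows "\<exists>r. homothetically_covered K A r"
proof -
  obtain c where "c \<in> interior K" using assms by blast
  then obtain e where e: "e > 0" "cball c e \<subseteq> K" by (auto simp: mem_interior_cball)
  obtain B where B: "B > 0" "\<And>a. a \<in> A \<Longrightarrow> norm a \<le> B"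
    using assms bounded_pos by blast
  \<comment> \<open>This factor blows the ball of radius \<open>e\<close> inside \<open>K\<close> up
    to radius \<open>B\<close>; the shift by \<open>- r *\<^sub>R c\<close> recentres it at the
    origin.\<close>
  define r where "r = B / e"
  have "r > 0" using B e by (simp add: r_def)
  have "a \<in> (\<lambda>y. r *\<^sub>R y + (- r *\<^sub>R c)) ` K" if "a \<in> A" for a
  proof (rule image_eqI)
    show "a = r *\<^sub>R (c + (1 / r) *\<^sub>R a) + (- r *\<^sub>R c)"
      using \<open>r > 0\<close> by (simp add: scaleR_add_right)
    have "norm a / r \<le> e" using B(2)[OF that] B(1) e by (simp add: r_def field_simps)
    then have "c + (1 / r) *\<^sub>R a \<in> cball c e" using \<open>r > 0\<close> by (simp add: dist_norm)
    then show "c + (1 / r) *\<^sub>R a \<in> K" using e by blast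
  qed
  then have "A \<subseteq> (\<lambda>y. r *\<^sub>R y + (- r *\<^sub>R c)) ` K" by blast
  then have "homothetically_covered K A r"
    using \<open>r > 0\<close> by (rule homothetically_coveredI[OF less_imp_le, rotated])
  then show ?thesis ..
qed

section \<open>The circumradius as a minimum, and its algebra\<close>

lemma gen_circumradius_le:
  assumes "homothetically_covered K A r"
  shows "gen_circumradius A K \<le> r"
  unfolding gen_circumradius_alt
  using assms by (intro cInf_lower bdd_belowI[of _ 0]) (auto simp: homothetically_covered_def)

lemma gen_circumradius_nonneg:
  assumes "convex_body K" "bounded A"
  shows "gen_circumradius A K \<ge> 0"
  unfolding gen_circumradius_alt
  using assms homothetically_covered_bounded[of K A]
  by (intro cInf_greatest) (auto simp: convex_body_def homothetically_covered_def)

text \<open>The pairs of factor and translation vector that cover \<open>A\<close>, with factor at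
  most some admissible \<open>M\<close>, form a compact set. Its projection to the factors therefore
  has a least element.\<close>

lemma gen_circumradius_attained:
  assumes K: "convex_body K" and A: "bounded A"
  shows "homothetically_covered K A (gen_circumradius A K)"
\<comment> \<open>For empty \<open>A\<close> the intersection defining \<open>T\<close> would be the
  whole space, which is not compact.\<close>
proof (cases "A = {}")
  case True
  then show ?thesis
    using gen_circumradius_nonneg[OF assms] by (simp add: homothetically_covered_def)
next
  case False
  obtain M where M: "homothetically_covered K A M"
    using homothetically_covered_bounded[of K A] assms by (auto simp: convex_body_def)
  \<comment> \<open>A single point \<open>a\<close> lies in \<open>r K + x\<close> exactly if
    \<open>x = a - r *\<^sub>R k\<close> for some \<open>k \<in> K\<close>, so its pairs form a
    continuous image of the compact set \<open>{0..M} \<times> K\<close>.\<close>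
  define T where "T = (\<Inter>a\<in>A. (\<lambda>(r, k). (r, a - r *\<^sub>R k)) ` ({0..M} \<times> K))"
  have T_iff: "(r, x) \<in> T \<longleftrightarrow> 0 \<le> r \<and> r \<le> M \<and> A \<subseteq> (\<lambda>k. r *\<^sub>R k + x) ` K" for r x
  proof -
    have "(r, x) \<in> T \<longleftrightarrow> (\<forall>a\<in>A. 0 \<le> r \<and> r \<le> M \<and> (\<exists>k\<in>K. x = a - r *\<^sub>R k))"
      unfolding T_def by (auto simp: image_iff)
    also have "\<dots> \<longleftrightarrow> 0 \<le> r \<and> r \<le> M \<and> (\<forall>a\<in>A. \<exists>k\<in>K. a = r *\<^sub>R k + x)"
      using False by (auto simp: algebra_simps)
    finally show ?thesis by (auto simp: image_iff subset_iff)
  qed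
  have "compact T"
    unfolding T_def using False K
    by (intro compact_Inter)
       (auto simp: convex_body_def case_prod_unfold
         intro!: compact_continuous_image compact_Times continuous_intros)
  then have "compact (fst ` T)"
    by (intro compact_continuous_image continuous_intros)
  have inT: "r \<in> fst ` T" if r: "homothetically_covered K A r" "r \<le> M" for r
  proof -
    obtain x where "r \<ge> 0" "A \<subseteq> (\<lambda>k. r *\<^sub>R k + x) ` K"
      using r by (auto simp: homothetically_covered_def)
    then have "(r, x) \<in> T" using r by (simp add: T_iff)
    then show ?thesis by (metis fst_conv imageI)
  qed
  have "fst ` T \<noteq> {}" using inT[OF M] by auto
  with \<open>compact (fst ` T)\<close> have "\<exists>m\<in>fst ` T. \<forall>r\<in>fst ` T. m \<le> r" by (intro compact_attains_inf)
  then obtain m where m: "m \<in> fst ` T" "\<And>r. r \<in> fst ` T \<Longrightarrow> m \<le> r" by blast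
  then obtain x where "(m, x) \<in> T" by auto
  then have adm: "homothetically_covered K A m" and "m \<le> M"
    unfolding T_iff by (blast intro: homothetically_coveredI)+
  have "m \<le> r" if "homothetically_covered K A r" for r
    using m(2) inT[OF that] \<open>m \<le> M\<close> by (cases "r \<le> M") auto
  then have "gen_circumradius A K = m"
    unfolding gen_circumradius_alt using adm by (intro cInf_eq_minimum) auto
  with adm show ?thesis by simp
qed

lemma gen_circumradius_add_le:
  assumes "convex_body K" "bounded A" "bounded B"
  shows "gen_circumradius (A + B) K \<le> gen_circumradius A K + gen_circumradius B K"
  using assms
  by (intro gen_circumradius_le homothetically_covered_Minkowski_sum gen_circumradius_attained)
     (auto simp: convex_body_def)

lemma gen_circumradius_scaleR_le:
  assumes "convex_body K" "bounded A" "s \<ge> 0"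
  shows "gen_circumradius ((\<lambda>x. s *\<^sub>R x) ` A) K \<le> s * gen_circumradius A K"
  using assms
  by (intro gen_circumradius_le homothetically_covered_scaleR gen_circumradius_attained)

lemma gen_circumradius_scaleR:
  assumes K: "convex_body K" and A: "bounded A" and s: "s \<ge> 0"
  shows "gen_circumradius ((\<lambda>x. s *\<^sub>R x) ` A) K = s * gen_circumradius A K"
proof (rule antisym)
  show "gen_circumradius ((\<lambda>x. s *\<^sub>R x) ` A) K \<le> s * gen_circumradius A K"
    using assms by (rule gen_circumradius_scaleR_le)
  have bdd: "bounded ((\<lambda>x. s *\<^sub>R x) ` A)" using A by (rule bounded_scaling)
  show "s * gen_circumradius A K \<le> gen_circumradius ((\<lambda>x. s *\<^sub>R x) ` A) K"
  proof (cases "s = 0")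
    case True
    then show ?thesis using gen_circumradius_nonneg[OF K bdd] by simp
  next
    case False
    then have "gen_circumradius A K \<le> (1 / s) * gen_circumradius ((\<lambda>x. s *\<^sub>R x) ` A) K"
      using gen_circumradius_scaleR_le[OF K bdd, of "1 / s"] s by (simp add: image_image)
    then show ?thesis using False s by (simp add: field_simps)
  qed
qed

text \<open>Both sets are covered with the larger of the two factors; undoing the two translations
  moves both into the same set \<open>r K\<close>.\<close>

lemma gen_circumradius_union_translates:
  assumes K: "convex_body K" and A: "bounded A" and B: "bounded B"
  shows "\<exists>a b. gen_circumradius ((\<lambda>x. x + a) ` A \<union> (\<lambda>x. x + b) ` B) K
           \<le> max (gen_circumradius A K) (gen_circumradius B K)"
proof -
  define r where "r = max (gen_circumradius A K) (gen_circumradius B K)"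
  have K': "convex K" "K \<noteq> {}" using K by (auto simp: convex_body_def)
  have "homothetically_covered K A r" "homothetically_covered K B r"
    by (rule homothetically_covered_mono[OF K' gen_circumradius_attained[OF K]]; simp add: r_def A B)+
  then obtain x y where "r \<ge> 0" and x: "A \<subseteq> (\<lambda>k. r *\<^sub>R k + x) ` K"
    and y: "B \<subseteq> (\<lambda>k. r *\<^sub>R k + y) ` K"
    by (auto simp: homothetically_covered_def)
  have "(\<lambda>v. v + - z) ` C \<subseteq> (\<lambda>k. r *\<^sub>R k + 0) ` K"
    if "C \<subseteq> (\<lambda>k. r *\<^sub>R k + z) ` K" for C z
    using image_mono[OF that, of "\<lambda>v. v + - z"] by (simp add: image_image)
  then have "(\<lambda>v. v + - x) ` A \<union> (\<lambda>v. v + - y) ` B \<subseteq> (\<lambda>k. r *\<^sub>R k + 0) ` K"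
    using x y by (intro Un_least)
  then have "homothetically_covered K ((\<lambda>v. v + - x) ` A \<union> (\<lambda>v. v + - y) ` B) r"
    using \<open>r \<ge> 0\<close> by (rule homothetically_coveredI[rotated])
  then show ?thesis unfolding r_def by (blast intro: gen_circumradius_le)
qed


section \<open>Sublinear diversities\<close>

lemma set_plus_singleton: "A + {x} = (\<lambda>y. y + x) ` (A :: 'a::ab_group_add set)"
  by (auto simp: set_plus_def)

locale sublinear =
  fixes \<delta> :: "'a::euclidean_space set \<Rightarrow> real"
  assumes sublinear: "sublinear_diversity \<delta>"
begin

lemma nonneg: "finite A \<Longrightarrow> \<delta> A \<ge> 0"
  and eq_0_iff: "finite A \<Longrightarrow> \<delta> A = 0 \<longleftrightarrow> card A \<le> 1"
  and triangle: "finite A \<Longrightarrow> finite B \<Longrightarrow> finite C \<Longrightarrow> B \<noteq> {} \<Longrightarrow>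
        \<delta> (A \<union> C) \<le> \<delta> (A \<union> B) + \<delta> (B \<union> C)"
  and add_le: "finite A \<Longrightarrow> finite B \<Longrightarrow> \<delta> (A + B) \<le> \<delta> A + \<delta> B"
  and scale: "finite A \<Longrightarrow> r \<ge> 0 \<Longrightarrow> \<delta> ((\<lambda>x. r *\<^sub>R x) ` A) = r * \<delta> A"
  using sublinear unfolding sublinear_diversity_def diversity_def by simp_all

lemma empty: "\<delta> {} = 0" and singleton: "\<delta> {x} = 0"
  by (simp_all add: eq_0_iff)

lemma mono:
  assumes "finite B" "A \<subseteq> B"
  shows "\<delta> A \<le> \<delta> B"
proof -
  have fin: "finite A" using assms finite_subset by blast
  have "\<delta> A \<le> \<delta> (A \<union> C)" if "finite C" for C
    using that
  proof (induction C)
    case (insert c C)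
    \<comment> \<open>Axiom (D2) with the empty set as third argument: adding one point cannot lower
      the value, because a singleton has value 0.\<close>
    have "\<delta> (A \<union> C) \<le> \<delta> ((A \<union> C) \<union> {c}) + \<delta> ({c} \<union> {})"
      using triangle[of "A \<union> C" "{c}" "{}"] insert fin by simp
    with insert.IH show ?case by (simp add: singleton)
  qed simp
  from this[OF \<open>finite B\<close>] show ?thesis using assms by (simp add: Un_absorb1)
qed

text \<open>Translation is Minkowski addition of a singleton, which costs nothing; translating back
  gives the other inequality.\<close>

lemma translate:
  assumes "finite A"
  shows "\<delta> ((\<lambda>x. x + a) ` A) = \<delta> A"
proof (rule antisym)
  have le: "\<delta> ((\<lambda>x. x + b) ` B) \<le> \<delta> B" if "finite B" for B b
    using add_le[of B "{b}"] that by (simp add: set_plus_singleton singleton)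
  show "\<delta> ((\<lambda>x. x + a) ` A) \<le> \<delta> A" using assms by (rule le)
  show "\<delta> A \<le> \<delta> ((\<lambda>x. x + a) ` A)"
    using le[of "(\<lambda>x. x + a) ` A" "- a"] assms by (simp add: image_image)
qed

section \<open>The norm induced by pairs of points\<close>

definition width :: "'a \<Rightarrow> real" where
  "width u = \<delta> {0, u}"

lemma pair_eq_width: "\<delta> {x, y} = width (y - x)"
  using translate[of "{0, y - x}" x] by (simp add: width_def)

lemma width_nonneg: "width u \<ge> 0"
  by (simp add: width_def nonneg)

lemma width_pos: "u \<noteq> 0 \<Longrightarrow> width u > 0"
  using eq_0_iff[of "{0, u}"] width_nonneg[of u] by (simp add: width_def)

lemma width_scaleR_nonneg: "r \<ge> 0 \<Longrightarrow> width (r *\<^sub>R u) = r * width u"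
  using scale[of "{0, u}" r] by (simp add: width_def)

lemma width_minus: "width (- u) = width u"
  using pair_eq_width[of 0 u] pair_eq_width[of u 0] by (simp add: insert_commute)

lemma width_scaleR: "width (r *\<^sub>R u) = \<bar>r\<bar> * width u"
  using width_scaleR_nonneg[of "\<bar>r\<bar>" u] width_minus[of "r *\<^sub>R u"] by (cases "r \<ge> 0") auto

text \<open>This is (D2) through the intermediate point \<open>u\<close>. It completes the proof
  that \<open>width\<close> is a norm; if \<open>\<delta>\<close> is the circumradius for
  \<open>K\<close>, its unit ball is the difference body \<open>K - K\<close>.\<close>

lemma width_add: "width (u + v) \<le> width u + width v"
proof -
  have "\<delta> ({0} \<union> {u + v}) \<le> \<delta> ({0} \<union> {u}) + \<delta> ({u} \<union> {u + v})"
    by (intro triangle) auto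
  then show ?thesis using pair_eq_width[of u "u + v"] by (simp add: width_def insert_commute)
qed

lemma width_sum: "finite I \<Longrightarrow> width (\<Sum>i\<in>I. f i) \<le> (\<Sum>i\<in>I. width (f i))"
proof (induction I rule: finite_induct)
  case empty
  then show ?case by (simp add: width_def singleton)
next
  case (insert i I)
  then show ?case using width_add[of "f i" "\<Sum>i\<in>I. f i"] by simp
qed

lemma width_upper: "\<exists>C>0. \<forall>u. width u \<le> C * norm u"
proof (intro exI conjI allI)
  \<comment> \<open>The summand 1 makes the constant positive using only that the sum is
    nonnegative.\<close>
  let ?C = "(\<Sum>b\<in>Basis. width b) + 1"
  have "(\<Sum>b\<in>Basis. width b) \<ge> (0::real)" by (intro sum_nonneg width_nonneg)
  then show "?C > 0" by simp
  fix u :: 'a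
  have "width u = width (\<Sum>b\<in>Basis. (u \<bullet> b) *\<^sub>R b)" by (simp add: euclidean_representation)
  also have "\<dots> \<le> (\<Sum>b\<in>Basis. \<bar>u \<bullet> b\<bar> * width b)"
    using width_sum[of Basis "\<lambda>b. (u \<bullet> b) *\<^sub>R b"] by (simp add: width_scaleR)
  also have "\<dots> \<le> (\<Sum>b\<in>Basis. norm u * width b)"
    by (intro sum_mono mult_right_mono width_nonneg Basis_le_norm)
  also have "\<dots> = (\<Sum>b\<in>Basis. width b) * norm u" by (simp add: sum_distrib_left mult.commute)
  also have "\<dots> \<le> ?C * norm u" by (intro mult_right_mono) auto
  finally show "width u \<le> ?C * norm u" .
qed

text \<open>Exchanging \<open>x\<close> and \<open>y\<close> makes the bound two-sided, and
  \<open>width_upper\<close> turns it into a Euclidean Lipschitz condition.\<close>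

lemma continuous_of_width_Lipschitz:
  assumes "\<And>x y. g x \<le> g y + width (x - y)"
  shows "continuous_on UNIV (g :: 'a \<Rightarrow> real)"
proof -
  obtain C where C: "C > 0" "\<And>u. width u \<le> C * norm u" using width_upper by blast
  have "dist (g x) (g y) \<le> C * dist x y" for x y
    using assms[of x y] assms[of y x] C(2)[of "x - y"] C(2)[of "y - x"]
    by (simp add: dist_norm norm_minus_commute abs_le_iff)
  then have "C-lipschitz_on UNIV g" using C by (intro lipschitz_onI) auto
  then show ?thesis by (rule lipschitz_on_continuous_on)
qed

text \<open>The constant is the minimum of \<open>width\<close> on the unit sphere: it is attained
  by compactness, positive by (D1), and extends to all vectors by homogeneity.\<close>

lemma width_lower: "\<exists>c>0. \<forall>u. c * norm u \<le> width u"
proof -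
  have "width x \<le> width y + width (x - y)" for x y
    using width_add[of y "x - y"] by simp
  then have "continuous_on UNIV width" by (rule continuous_of_width_Lipschitz)
  then have "continuous_on (sphere 0 1) width" by (rule continuous_on_subset) simp
  moreover have "sphere (0::'a) 1 \<noteq> {}" by simp
  ultimately obtain v where v: "v \<in> sphere 0 1" "\<And>u. u \<in> sphere 0 1 \<Longrightarrow> width v \<le> width u"
    using continuous_attains_inf[OF compact_sphere] by metis
  have "width v * norm u \<le> width u" for u
  proof (cases "u = 0")
    case False
    then have "width v \<le> width ((1 / norm u) *\<^sub>R u)" by (intro v) auto
    then show ?thesis using False by (simp add: width_scaleR field_simps)
  qed (simp add: width_nonneg)
  moreover have "width v > 0" using v(1) by (intro width_pos) auto
  ultimately show ?thesis by blast
qed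

text \<open>Adding the pair \<open>{0, x - y}\<close> keeps \<open>F\<close> and also moves
  \<open>A + y\<close> onto \<open>A + x\<close>, so subadditivity bounds the change. The resulting
  continuity in the translation vector drives the closedness and compactness arguments.\<close>

lemma union_translate_Lipschitz:
  assumes "finite F" "finite A"
  shows "\<delta> (F \<union> (\<lambda>v. v + x) ` A) \<le> \<delta> (F \<union> (\<lambda>v. v + y) ` A) + width (x - y)"
proof -
  have "F \<union> (\<lambda>v. v + x) ` A \<subseteq> (F \<union> (\<lambda>v. v + y) ` A) + {0, x - y}"
  proof
    fix z assume "z \<in> F \<union> (\<lambda>v. v + x) ` A"
    then consider "z \<in> F" | v where "v \<in> A" "z = v + x" by blast
    then show "z \<in> (F \<union> (\<lambda>v. v + y) ` A) + {0, x - y}"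
    proof cases
      case 1
      then have "z + 0 \<in> (F \<union> (\<lambda>v. v + y) ` A) + {0, x - y}" by (intro set_plus_intro) auto
      then show ?thesis by simp
    next
      case 2
      then have "(v + y) + (x - y) \<in> (F \<union> (\<lambda>v. v + y) ` A) + {0, x - y}"
        by (intro set_plus_intro) auto
      then show ?thesis using 2 by simp
    qed
  qed
  then have "\<delta> (F \<union> (\<lambda>v. v + x) ` A) \<le> \<delta> ((F \<union> (\<lambda>v. v + y) ` A) + {0, x - y})"
    using assms by (intro mono) (auto intro: finite_set_plus)
  also have "\<dots> \<le> \<delta> (F \<union> (\<lambda>v. v + y) ` A) + width (x - y)"
    unfolding width_def using assms by (intro add_le) auto
  finally show ?thesis .
qed

text \<open>The enlarged set lies in \<open>s F + t F\<close>, whose value is at most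
  \<open>(s + t) * \<delta> F\<close>. This will make maximal sets convex.\<close>

lemma insert_convex_combination:
  assumes "finite F" "x \<in> F" "y \<in> F" "s \<ge> 0" "t \<ge> 0" "s + t = 1"
  shows "\<delta> (insert (s *\<^sub>R x + t *\<^sub>R y) F) \<le> \<delta> F"
proof -
  let ?G = "(\<lambda>v. s *\<^sub>R v) ` F + (\<lambda>v. t *\<^sub>R v) ` F"
  have "v \<in> ?G" if "v \<in> F" for v
  proof -
    have "s *\<^sub>R v + t *\<^sub>R v \<in> ?G" using that by (intro set_plus_intro) auto
    then show ?thesis using assms by (simp flip: scaleR_add_left)
  qed
  then have "insert (s *\<^sub>R x + t *\<^sub>R y) F \<subseteq> ?G"
    using assms by (auto intro: set_plus_intro)
  then have "\<delta> (insert (s *\<^sub>R x + t *\<^sub>R y) F) \<le> \<delta> ?G"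
    using assms by (intro mono) (auto intro: finite_set_plus)
  also have "\<dots> \<le> s * \<delta> F + t * \<delta> F"
    using add_le[of "(\<lambda>v. s *\<^sub>R v) ` F" "(\<lambda>v. t *\<^sub>R v) ` F"] assms by (simp add: scale)
  also have "\<dots> = \<delta> F" using assms by (simp flip: distrib_right)
  finally show ?thesis .
qed

text \<open>Testing finite subsets only lets infinite sets be measured, although
  \<open>\<delta>\<close> is meaningful on finite sets alone, and gives a property of finite
  character, as needed for Zorn's lemma.\<close>

definition short :: "'a set \<Rightarrow> bool" where
  "short S \<longleftrightarrow> (\<forall>F. finite F \<and> F \<subseteq> S \<longrightarrow> \<delta> F \<le> 1)"

lemma shortD: "short S \<Longrightarrow> finite F \<Longrightarrow> F \<subseteq> S \<Longrightarrow> \<delta> F \<le> 1"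
  by (auto simp: short_def)

lemma short_Un:
  assumes "finite B" "\<And>F. finite F \<Longrightarrow> F \<subseteq> S \<Longrightarrow> \<delta> (F \<union> B) \<le> 1"
  shows "short (S \<union> B)"
  unfolding short_def
proof (intro allI impI)
  fix F assume F: "finite F \<and> F \<subseteq> S \<union> B"
  then have "\<delta> F \<le> \<delta> ((F \<inter> S) \<union> B)" using assms(1) by (intro mono) auto
  also have "\<dots> \<le> 1" using F by (intro assms) auto
  finally show "\<delta> F \<le> 1" .
qed

lemma maximal_short_exists: "\<exists>K. short K \<and> (\<forall>S. short S \<and> K \<subseteq> S \<longrightarrow> S = K)"
proof -
  have "\<exists>K\<in>Collect short. \<forall>S\<in>Collect short. K \<subseteq> S \<longrightarrow> S = K"
  proof (rule subset_Zorn_nonempty)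
    have "short {}" by (simp add: short_def empty)
    then show "Collect short \<noteq> {}" by blast
    fix \<C> assume \<C>: "\<C> \<noteq> {}" "subset.chain (Collect short) \<C>"
    have "\<delta> F \<le> 1" if F: "finite F" "F \<subseteq> \<Union>\<C>" for F
    proof -
      obtain S where "S \<in> \<C>" "F \<subseteq> S"
        \<comment> \<open>A finite subset of the union of a nonempty chain already lies in one
          member.\<close>
        using finite_subset_Union_chain[OF F \<C>] .
      moreover have "short S" using \<C> \<open>S \<in> \<C>\<close> by (auto simp: subset.chain_def)
      ultimately show ?thesis using shortD \<open>finite F\<close> by blast
    qed
    then show "\<Union>\<C> \<in> Collect short" by (simp add: short_def)
  qed
  then show ?thesis by blast
qed

end

section \<open>Geometry of a maximal short set\<close>

locale maximal_short = sublinear +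
  fixes K :: "'a set"
  assumes short_K: "short K"
    and maximal: "short S \<Longrightarrow> K \<subseteq> S \<Longrightarrow> S = K"
begin

text \<open>The form in which maximality is applied: points compatible with every finite part of
  \<open>K\<close> already belong to \<open>K\<close>.\<close>

lemma absorb:
  assumes "finite B" "\<And>F. finite F \<Longrightarrow> F \<subseteq> K \<Longrightarrow> \<delta> (F \<union> B) \<le> 1"
  shows "B \<subseteq> K"
  using maximal[OF short_Un[OF assms]] by blast

lemma nonempty: "K \<noteq> {}"
  using absorb[of "{0}"] by (force simp: singleton)

lemma convex: "convex K"
proof (rule convexI)
  fix x y s t assume *: "x \<in> K" "y \<in> K" "(0::real) \<le> s" "0 \<le> t" "s + t = 1"
  have "{s *\<^sub>R x + t *\<^sub>R y} \<subseteq> K"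
  proof (rule absorb)
    fix F assume F: "finite F" "F \<subseteq> K"
    have "\<delta> (F \<union> {s *\<^sub>R x + t *\<^sub>R y}) \<le> \<delta> (insert (s *\<^sub>R x + t *\<^sub>R y) ({x, y} \<union> F))"
      using F by (intro mono) auto
    also have "\<dots> \<le> \<delta> ({x, y} \<union> F)"
      using F * by (intro insert_convex_combination) auto
    also have "\<dots> \<le> 1" using F * by (intro shortD[OF short_K]) auto
    finally show "\<delta> (F \<union> {s *\<^sub>R x + t *\<^sub>R y}) \<le> 1" .
  qed simp
  then show "s *\<^sub>R x + t *\<^sub>R y \<in> K" by simp
qed

lemma closed_translates:
  assumes "finite F" "finite A"
  shows "closed {x. \<delta> (F \<union> (\<lambda>v. v + x) ` A) \<le> 1}"
  by (intro closed_Collect_le continuous_on_const continuous_of_width_Lipschitz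
        union_translate_Lipschitz assms)

lemma closed: "closed K"
proof -
  have "z \<in> K" if z: "z \<in> closure K" for z
  proof -
    have "{z} \<subseteq> K"
    proof (rule absorb)
      fix F assume F: "finite F" "F \<subseteq> K"
      \<comment> \<open>The point \<open>x\<close> is written as a translate of \<open>{0}\<close>
        so that \<open>closed_translates\<close> applies; a closed set containing \<open>K\<close>
        contains its closure.\<close>
      have "K \<subseteq> {x. \<delta> (F \<union> (\<lambda>v. v + x) ` {0}) \<le> 1}"
        using F by (auto intro!: shortD[OF short_K])
      then have "closure K \<subseteq> {x. \<delta> (F \<union> (\<lambda>v. v + x) ` {0}) \<le> 1}"
        using F by (intro closure_minimal closed_translates) auto
      then show "\<delta> (F \<union> {z}) \<le> 1" using z by auto
    qed simp
    then show ?thesis by simp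
  qed
  then show ?thesis by (meson closure_subset_eq subsetI)
qed

lemma bounded: "bounded K"
proof -
  obtain c where c: "c > 0" "\<And>u. c * norm u \<le> width u" using width_lower by blast
  obtain k where "k \<in> K" using nonempty by blast
  have "dist k x \<le> 1 / c" if "x \<in> K" for x
  proof -
    have "c * norm (x - k) \<le> \<delta> {k, x}" using c by (simp add: pair_eq_width)
    also have "\<dots> \<le> 1" using that \<open>k \<in> K\<close> by (intro shortD[OF short_K]) auto
    finally show ?thesis using c(1) by (simp add: field_simps dist_norm norm_minus_commute)
  qed
  then show ?thesis unfolding bounded_def by blast
qed

text \<open>For each finite \<open>F \<subseteq> K\<close>, the vectors moving \<open>A\<close> to a
  place compatible with \<open>F\<close> form a nonempty compact set that shrinks as
  \<open>F\<close> grows. The finite intersection property yields one vector good for all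
  \<open>F\<close>, and \<open>absorb\<close> finishes.\<close>

lemma contains_translate:
  assumes un: "\<And>A B. finite A \<Longrightarrow> finite B \<Longrightarrow>
      \<exists>a b. \<delta> ((\<lambda>x. x + a) ` A \<union> (\<lambda>x. x + b) ` B) \<le> max (\<delta> A) (\<delta> B)"
    and A: "finite A" "\<delta> A \<le> 1"
  shows "\<exists>x. (\<lambda>v. v + x) ` A \<subseteq> K"
proof (cases "A = {}")
  case False
  then obtain a where a: "a \<in> A" by blast
  obtain k where k: "k \<in> K" using nonempty by blast
  obtain c where c: "c > 0" "\<And>u. c * norm u \<le> width u" using width_lower by blast
  \<comment> \<open>Inserting the fixed point \<open>k\<close> anchors the translates of
    \<open>A\<close>; for empty \<open>F\<close> without it, every vector would qualify and
    compactness would be lost.\<close>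
  define P where "P = (\<lambda>F. {x. \<delta> (insert k F \<union> (\<lambda>v. v + x) ` A) \<le> 1})"
  define \<F> where "\<F> = {F. finite F \<and> F \<subseteq> K}"
  have P_nonempty: "P F \<noteq> {}" if "F \<in> \<F>" for F
  proof -
    have F: "finite (insert k F)" "insert k F \<subseteq> K" using that k by (auto simp: \<F>_def)
    obtain p q where pq: "\<delta> ((\<lambda>x. x + p) ` insert k F \<union> (\<lambda>x. x + q) ` A)
        \<le> max (\<delta> (insert k F)) (\<delta> A)"
      using un[OF F(1) A(1)] by blast
    also have "\<dots> \<le> 1" using shortD[OF short_K F] A by simp
    \<comment> \<open>The hypothesis moves both sets; translating back by \<open>p\<close> restores
      \<open>insert k F\<close> and leaves \<open>A\<close> shifted by \<open>q - p\<close>.\<close>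
    finally have "\<delta> ((\<lambda>v. v + - p) ` ((\<lambda>x. x + p) ` insert k F \<union> (\<lambda>x. x + q) ` A)) \<le> 1"
      using F A by (subst translate) auto
    moreover have "(\<lambda>v. v + - p) ` ((\<lambda>x. x + p) ` insert k F \<union> (\<lambda>x. x + q) ` A)
        = insert k F \<union> (\<lambda>v. v + (q - p)) ` A"
      by (simp add: image_Un image_image add_diff_eq)
    ultimately show ?thesis unfolding P_def by fastforce
  qed
  have P_bound: "x \<in> cball (k - a) (1 / c)" if "x \<in> P F" "F \<in> \<F>" for x F
  proof -
    have "c * norm ((a + x) - k) \<le> \<delta> {k, a + x}" using c by (simp add: pair_eq_width)
    also have "\<dots> \<le> \<delta> (insert k F \<union> (\<lambda>v. v + x) ` A)"
      using a A that by (intro mono) (auto simp: \<F>_def)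
    also have "\<dots> \<le> 1" using that by (simp add: P_def)
    finally show ?thesis using c(1)
      by (simp add: field_simps dist_norm norm_minus_commute)
  qed
  have P_closed: "closed (P F)" if "F \<in> \<F>" for F
    unfolding P_def using that A by (intro closed_translates) (auto simp: \<F>_def)
  have P_compact: "compact (P F)" if "F \<in> \<F>" for F
  proof -
    have "bounded (P F)" using P_bound that by (intro bounded_subset[OF bounded_cball]) blast
    then show ?thesis using P_closed that by (simp add: compact_eq_bounded_closed)
  qed
  have "{} \<in> \<F>" by (simp add: \<F>_def)
  \<comment> \<open>\<open>P {}\<close> is the ambient compact set. For a finite subfamily,
    \<open>P\<close> of its union is a nonempty subset of the intersection.\<close>
  have "P {} \<inter> (\<Inter>F\<in>\<F>. P F) \<noteq> {}"
  proof (rule compact_imp_fip_image)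
    fix I assume I: "finite I" "I \<subseteq> \<F>"
    have U: "\<Union>I \<in> \<F>" using I by (auto simp: \<F>_def)
    have anti: "P (\<Union>I) \<subseteq> P F" if "F \<subseteq> \<Union>I" for F
    proof
      fix x assume x: "x \<in> P (\<Union>I)"
      have "\<delta> (insert k F \<union> (\<lambda>v. v + x) ` A) \<le> \<delta> (insert k (\<Union>I) \<union> (\<lambda>v. v + x) ` A)"
        using that U A by (intro mono) (auto simp: \<F>_def)
      also have "\<dots> \<le> 1" using x by (simp add: P_def)
      finally show "x \<in> P F" by (simp add: P_def)
    qed
    have "P (\<Union>I) \<subseteq> P {} \<inter> (\<Inter>F\<in>I. P F)" using anti by blast
    then show "P {} \<inter> (\<Inter>F\<in>I. P F) \<noteq> {}" using P_nonempty[OF U] by blast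
  qed (use P_compact P_closed \<open>{} \<in> \<F>\<close> in auto)
  then obtain x where x: "\<And>F. F \<in> \<F> \<Longrightarrow> x \<in> P F" by blast
  have "(\<lambda>v. v + x) ` A \<subseteq> K"
  proof (rule absorb)
    fix F assume F: "finite F" "F \<subseteq> K"
    have "\<delta> (F \<union> (\<lambda>v. v + x) ` A) \<le> \<delta> (insert k F \<union> (\<lambda>v. v + x) ` A)"
      using F A by (intro mono) auto
    also have "\<dots> \<le> 1" using x[of F] F by (simp add: P_def \<F>_def)
    finally show "\<delta> (F \<union> (\<lambda>v. v + x) ` A) \<le> 1" .
  qed (use A in simp)
  then show ?thesis by blast
qed simp

text \<open>A finite set in \<open>r K + x\<close> is the homothetic image of a finite
  \<open>F \<subseteq> K\<close>, and \<open>\<delta> F \<le> 1\<close>.\<close>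

lemma homothetically_covered_imp_le:
  assumes "finite A" "homothetically_covered K A r"
  shows "\<delta> A \<le> r"
proof -
  obtain x where "r \<ge> 0" and x: "A \<subseteq> (\<lambda>k. r *\<^sub>R k + x) ` K"
    using assms by (auto simp: homothetically_covered_def)
  obtain F where F: "F \<subseteq> K" "finite F" "A = (\<lambda>k. r *\<^sub>R k + x) ` F"
    using finite_subset_image[OF assms(1) x] by blast
  have "A = (\<lambda>v. v + x) ` (\<lambda>k. r *\<^sub>R k) ` F" using F by (simp add: image_image)
  then have "\<delta> A = r * \<delta> F" using F \<open>r \<ge> 0\<close> by (simp add: translate scale)
  also have "\<dots> \<le> r" using shortD[OF short_K] F \<open>r \<ge> 0\<close> by (simp add: mult_left_le)
  finally show ?thesis .
qed

section \<open>Recovering the diversity from \<open>K\<close> under the union property\<close>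

context
  assumes union_translates: "\<And>A B. finite A \<Longrightarrow> finite B \<Longrightarrow>
      \<exists>a b. \<delta> ((\<lambda>x. x + a) ` A \<union> (\<lambda>x. x + b) ` B) \<le> max (\<delta> A) (\<delta> B)"
begin

text \<open>Rescaling by \<open>1 / r\<close> brings the value down to at most 1, so a translate
  fits into \<open>K\<close>; scaling back turns the shift \<open>x\<close> into
  \<open>- r *\<^sub>R x\<close>.\<close>

lemma le_imp_homothetically_covered:
  assumes "finite A" "\<delta> A \<le> r" "r > 0"
  shows "homothetically_covered K A r"
proof -
  have "\<delta> ((\<lambda>v. (1 / r) *\<^sub>R v) ` A) \<le> 1" using assms by (subst scale) auto
  then obtain x where x: "(\<lambda>v. v + x) ` (\<lambda>v. (1 / r) *\<^sub>R v) ` A \<subseteq> K"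
    using contains_translate[OF union_translates] assms by blast
  have "v \<in> (\<lambda>k. r *\<^sub>R k + (- r *\<^sub>R x)) ` K" if "v \<in> A" for v
  proof (rule image_eqI)
    show "v = r *\<^sub>R ((1 / r) *\<^sub>R v + x) + (- r *\<^sub>R x)"
      using \<open>r > 0\<close> by (simp add: scaleR_add_right)
    show "(1 / r) *\<^sub>R v + x \<in> K" using x that by blast
  qed
  then have "A \<subseteq> (\<lambda>k. r *\<^sub>R k + (- r *\<^sub>R x)) ` K" by blast
  then have "homothetically_covered K A r"
    using \<open>r > 0\<close> by (rule homothetically_coveredI[OF less_imp_le, rotated])
  then show ?thesis .
qed

lemma eq_gen_circumradius:
  assumes "finite A"
  shows "\<delta> A = gen_circumradius A K"
proof -
  \<comment> \<open>The slack \<open>e\<close> keeps the factor positive even when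
    \<open>\<delta> A = 0\<close>.\<close>
  have cov: "homothetically_covered K A (\<delta> A + e)" if "e > 0" for e
    using that nonneg[OF assms] assms by (intro le_imp_homothetically_covered) auto
  show ?thesis
  proof (rule antisym)
    show "\<delta> A \<le> gen_circumradius A K"
      unfolding gen_circumradius_alt using cov[of 1] homothetically_covered_imp_le[OF assms]
      by (intro cInf_greatest) auto
    show "gen_circumradius A K \<le> \<delta> A"
      using cov gen_circumradius_le by (blast intro: field_le_epsilon)
  qed
qed

text \<open>The vertices of the standard simplex form a finite set, so some homothet of
  \<open>K\<close> contains them and, by convexity, the whole simplex, which has interior
  points.\<close>

lemma interior_nonempty: "interior K \<noteq> {}"
proof -
  let ?S = "insert 0 (Basis :: 'a set)"
  define r where "r = \<delta> ?S + 1"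
  have "r > 0" using nonneg[of ?S] by (simp add: r_def)
  then have "homothetically_covered K ?S r"
    by (intro le_imp_homothetically_covered) (auto simp: r_def)
  then obtain x where "?S \<subseteq> (\<lambda>k. r *\<^sub>R k + x) ` K" by (auto simp: homothetically_covered_def)
  then have sub: "?S \<subseteq> (\<lambda>v. x + v) ` (\<lambda>k. r *\<^sub>R k) ` K" by (simp add: image_image add.commute)
  have "convex ((\<lambda>v. x + v) ` (\<lambda>k. r *\<^sub>R k) ` K)"
    using convex by (intro convex_translation convex_scaling)
  then have "convex hull ?S \<subseteq> (\<lambda>v. x + v) ` (\<lambda>k. r *\<^sub>R k) ` K"
    using sub by (rule hull_minimal[rotated])
  moreover obtain z where "z \<in> interior (convex hull ?S)"
    using interior_simplex_nonempty[OF independent_Basis finite_Basis] by auto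
  ultimately have "z \<in> interior ((\<lambda>v. x + v) ` (\<lambda>k. r *\<^sub>R k) ` K)"
    using interior_mono by blast
  then have "z \<in> (\<lambda>v. x + v) ` (\<lambda>k. r *\<^sub>R k) ` interior K"
    using \<open>r > 0\<close> by (simp add: interior_translation interior_injective_linear_image
      inj_on_def linear_scaleR)
  then show ?thesis by blast
qed

lemma convex_body: "convex_body K"
  by (simp add: convex_body_def compact_eq_bounded_closed bounded closed convex interior_nonempty)

end

end

section \<open>The two directions of the characterization\<close>

lemma Minkowski_diversity_imp_sublinear:
  assumes "Minkowski_diversity \<delta>"
  shows "sublinear_diversity \<delta>"
proof -
  obtain K where K: "convex_body K" and \<delta>: "\<forall>A. finite A \<longrightarrow> \<delta> A = gen_circumradius A K"
    using assms unfolding Minkowski_diversity_def by blast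
  have "diversity UNIV \<delta>" using assms by (simp add: Minkowski_diversity_def)
  moreover have "\<delta> (A + B) \<le> \<delta> A + \<delta> B" if "finite A" "finite B" for A B
    using that gen_circumradius_add_le[OF K, of A B]
    by (simp add: \<delta> finite_set_plus finite_imp_bounded)
  moreover have "\<delta> ((\<lambda>x. r *\<^sub>R x) ` A) = r * \<delta> A" if "finite A" "r \<ge> 0" for A r
    using that gen_circumradius_scaleR[OF K, of A r] by (simp add: \<delta> finite_imp_bounded)
  ultimately show ?thesis by (simp add: sublinear_diversity_def)
qed

lemma Minkowski_diversity_union_translates:
  assumes "Minkowski_diversity \<delta>" "finite A" "finite B"
  shows "\<exists>a b. \<delta> ((\<lambda>x. x + a) ` A \<union> (\<lambda>x. x + b) ` B) \<le> max (\<delta> A) (\<delta> B)"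
proof -
  obtain K where K: "convex_body K" and \<delta>: "\<forall>A. finite A \<longrightarrow> \<delta> A = gen_circumradius A K"
    using assms unfolding Minkowski_diversity_def by blast
  obtain a b where "gen_circumradius ((\<lambda>x. x + a) ` A \<union> (\<lambda>x. x + b) ` B) K
      \<le> max (gen_circumradius A K) (gen_circumradius B K)"
    using gen_circumradius_union_translates[OF K] assms finite_imp_bounded by blast
  then have "\<delta> ((\<lambda>x. x + a) ` A \<union> (\<lambda>x. x + b) ` B) \<le> max (\<delta> A) (\<delta> B)"
    using assms by (simp add: \<delta>)
  then show ?thesis by blast
qed

lemma sublinear_union_translates_imp_Minkowski:
  assumes "sublinear_diversity \<delta>"
    and "\<And>A B. finite A \<Longrightarrow> finite B \<Longrightarrow>
      \<exists>a b. \<delta> ((\<lambda>x. x + a) ` A \<union> (\<lambda>x. x + b) ` B) \<le> max (\<delta> A) (\<delta> B)"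
  shows "Minkowski_diversity \<delta>"
proof -
  interpret sublinear \<delta> by (rule sublinear.intro) (rule assms(1))
  obtain K where K: "short K" "\<forall>S. short S \<and> K \<subseteq> S \<longrightarrow> S = K"
    using maximal_short_exists by (rule exE) (erule conjE)
  interpret maximal_short \<delta> K by unfold_locales (simp_all add: K)
  have "convex_body K" by (rule convex_body) (rule assms(2))
  moreover have "\<forall>A. finite A \<longrightarrow> \<delta> A = gen_circumradius A K"
    by (intro allI impI eq_gen_circumradius) (rule assms(2))
  moreover have "diversity UNIV \<delta>" using assms(1) by (simp add: sublinear_diversity_def)
  ultimately show ?thesis by (auto simp only: Minkowski_diversity_def)
qed

theorem theorem8:
  fixes \<delta> :: "(real ^ 'd) set \<Rightarrow> real"
  assumes "diversity UNIV \<delta>"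
  shows "Minkowski_diversity \<delta> \<longleftrightarrow>
    sublinear_diversity \<delta> \<and>
    (\<forall>A B. finite A \<and> finite B \<longrightarrow>
       (\<exists>a b. \<delta> ((\<lambda>x. x + a) ` A \<union> (\<lambda>x. x + b) ` B) \<le> max (\<delta> A) (\<delta> B)))"
proof (intro iffI conjI allI impI)
  assume M: "Minkowski_diversity \<delta>"
  then show "sublinear_diversity \<delta>" by (rule Minkowski_diversity_imp_sublinear)
  fix A B :: "(real ^ 'd) set"
  assume "finite A \<and> finite B"
  then show "\<exists>a b. \<delta> ((\<lambda>x. x + a) ` A \<union> (\<lambda>x. x + b) ` B) \<le> max (\<delta> A) (\<delta> B)"
    using M by (intro Minkowski_diversity_union_translates) auto
next
  assume *: "sublinear_diversity \<delta> \<and> (\<forall>A B. finite A \<and> finite B \<longrightarrow>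
    (\<exists>a b. \<delta> ((\<lambda>x. x + a) ` A \<union> (\<lambda>x. x + b) ` B) \<le> max (\<delta> A) (\<delta> B)))"
  show "Minkowski_diversity \<delta>"
    by (rule sublinear_union_translates_imp_Minkowski) (simp_all add: *)
qed

end
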